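(* Let $(x_1,y_1),(x_2,y_2) \in \mathbb{R}^2$ be any two points and let $c_1,c_2,c_3 \in \mathbb{R}$ be any constants such that $$c_1 = c_3 \iff (x_1 = x_2 \text{ and } y_1 = y_2).$$ Then the pair $(x_1,y_1),(x_2,y_2)$ can be transformed into the pair $(c_1,c_2),(c_3,c_2)$ by applying a rotation about the origin, an $x$-scale, and an $xy$-translation; that is, there exist $t_x,t_y,d_x,d_y,s_x\in\mathbb{R}$ with $s_x>0$ and $d_x^2+d_y^2=1$ such that, with $$S=\begin{pmatrix} s_x & 0\\ 0 & 1\end{pmatrix},\qquad R=\begin{pmatrix} d_x & -d_y\\ d_y & d_x\end{pmatrix},\qquad T=\begin{pmatrix} t_x\\ t_y\end{pmatrix},$$ one has $$\begin{pmatrix} c_1\\ c_2\end{pmatrix} = S R \begin{pmatrix} x_1\\ y_1\end{pmatrix}+T \quad\text{and}\quad \begin{pmatrix} c_3\\ c_2\end{pmatrix} = S R \begin{pmatrix} x_2\\ y_2\end{pmatrix}+T .$$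
   Context: An $x$-scale is the linear map $(x,y)\mapsto(s_x x, y)$ with $s_x>0$; an $xy$-translation is the map $(x,y)\mapsto(x+t_x,y+t_y)$; a rotation about the origin is given by a matrix $\begin{pmatrix}\cos\theta & -\sin\theta\\ \sin\theta&\cos\theta\end{pmatrix}$, where any angle $\theta$ (including $\theta=0$) is allowed. *)

theory Defs
  imports "HOL-Analysis.Analysis"
begin

(* The outer list runs over the rows. *)

definition x_scale_matrix :: "real \<Rightarrow> real^2^2" where
  "x_scale_matrix s = vector [vector [s, 0], vector [0, 1]]"

(* This is a rotation about the origin exactly when dx^2 + dy^2 = 1,
   with dx and dy the cosine and sine of the angle. *)
definition plane_rotation_matrix :: "real \<Rightarrow> real \<Rightarrow> real^2^2" where
  "plane_rotation_matrix dx dy = vector [vector [dx, - dy], vector [dy, dx]]"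

end

theory Submission
  imports Defs
begin

text \<open>
  Rotate the difference vector of the two points onto the half-line of the \<open>x\<close>-axis that points in
  the direction of the sign of \<open>c3 - c1\<close>. This equalises the second coordinates, the \<open>x\<close>-scale then
  corrects the distance to \<open>\<bar>c3 - c1\<bar>\<close>, and the translation is determined by the first point.
\<close>

lemma vec_2_eq_iff: "(v::'a^2) = w \<longleftrightarrow> v$1 = w$1 \<and> v$2 = w$2"
  by (simp add: vec_eq_iff forall_2)

lemma x_scale_rotation_apply:
  "(x_scale_matrix s ** plane_rotation_matrix dx dy) *v vector [x, y]
     = vector [s * (dx * x - dy * y), dy * x + dx * y]"
  by (simp add: vec_2_eq_iff x_scale_matrix_def plane_rotation_matrix_def
      matrix_vector_mult_def matrix_matrix_mult_def sum_2 vector_2 algebra_simps)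

text \<open>Subtracting the two required equations cancels the translation, so only the difference
  \<open>(u, v)\<close> of the points and \<open>d = c3 - c1\<close> matter.\<close>

lemma rotate_scale_to_x_axis:
  fixes u v d :: real
  assumes "d = 0 \<longleftrightarrow> u = 0 \<and> v = 0"
  obtains dx dy s where "s > 0" "dx\<^sup>2 + dy\<^sup>2 = 1"
    "s * (dx * u - dy * v) = d" "dy * u + dx * v = 0"
proof (cases "d = 0")
  case True
  \<comment> \<open>The vector is zero, so the identity serves: \<open>s = 1\<close>,
    \<open>dx = 1\<close>, \<open>dy = 0\<close>.\<close>
  with assms show thesis by (intro that[of 1 1 0]) auto
next
  case False
  define r where "r = sqrt (u\<^sup>2 + v\<^sup>2)"
  have r: "r > 0"
    using assms False by (simp add: r_def sum_power2_gt_zero_iff)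
  have r2: "r\<^sup>2 = u\<^sup>2 + v\<^sup>2"
    by (simp add: r_def)
  have sgn2: "(sgn d)\<^sup>2 = 1"
    using False by (simp add: sgn_if)
  show thesis
  \<comment> \<open>The rotation with cosine \<open>u / r\<close> and sine \<open>- v / r\<close>
    takes \<open>(u, v)\<close> to \<open>(r, 0)\<close>. The factor \<open>sgn d\<close> adds a
    half turn when \<open>d < 0\<close>, which lets the scale stay positive.\<close>
  proof (rule that[of "\<bar>d\<bar> / r" "sgn d * u / r" "- sgn d * v / r"])
    show "\<bar>d\<bar> / r > 0"
      using False r by simp
    show "(sgn d * u / r)\<^sup>2 + (- sgn d * v / r)\<^sup>2 = 1"
      using r by (simp add: power_divide power_mult_distrib sgn2 flip: add_divide_distrib r2)
    have "\<bar>d\<bar> / r * (sgn d * u / r * u - - sgn d * v / r * v) = \<bar>d\<bar> * sgn d * (u\<^sup>2 + v\<^sup>2) / r\<^sup>2"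
      using r by (simp add: field_simps power2_eq_square)
    also have "\<dots> = d"
      using r by (simp add: abs_mult_sgn flip: r2)
    finally show "\<bar>d\<bar> / r * (sgn d * u / r * u - - sgn d * v / r * v) = d" .
    show "- sgn d * v / r * u + sgn d * u / r * v = 0"
      by simp
  qed
qed

theorem theorem2:
  fixes x1 y1 x2 y2 c1 c2 c3 :: real
  assumes "c1 = c3 \<longleftrightarrow> (x1 = x2 \<and> y1 = y2)"
  shows "\<exists>tx ty dx dy sx :: real. sx > 0 \<and> dx\<^sup>2 + dy\<^sup>2 = 1 \<and>
    (let S = x_scale_matrix sx; R = plane_rotation_matrix dx dy; T = vector [tx, ty] :: real^2 in
      vector [c1, c2] = (S ** R) *v vector [x1, y1] + T \<and>
      vector [c3, c2] = (S ** R) *v vector [x2, y2] + T)"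
proof -
  have "c3 - c1 = 0 \<longleftrightarrow> x2 - x1 = 0 \<and> y2 - y1 = 0"
    using assms by auto
  then obtain dx dy s where s: "s > 0" "dx\<^sup>2 + dy\<^sup>2 = 1"
    and eqs: "s * (dx * (x2 - x1) - dy * (y2 - y1)) = c3 - c1"
      "dy * (x2 - x1) + dx * (y2 - y1) = 0"
    by (rule rotate_scale_to_x_axis)
  show ?thesis
    unfolding Let_def x_scale_rotation_apply
    \<comment> \<open>These translations solve the equations of the first point; adding
      \<open>eqs\<close> gives those of the second.\<close>
    by (rule exI[of _ "c1 - s * (dx * x1 - dy * y1)"], rule exI[of _ "c2 - (dy * x1 + dx * y1)"],
        rule exI[of _ dx], rule exI[of _ dy], rule exI[of _ s])
      (use s eqs in \<open>simp add: vec_2_eq_iff vector_2 algebra_simps\<close>)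
qed

end
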